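(* Let $P,Q\in S^3((k^2)^* )$. Then $$\omega(\Psi(P),Q)^2-9Q_n(P)\,\omega(P,Q)^2=-\frac92\,\omega(\mu(P)^{\otimes3}\cdot Q,Q)-\frac92\,Q_n(P)\,\omega(\mu(P)\cdot Q,Q),$$ where $\mu(P)^{\otimes3}$ denotes the unique endomorphism of $S^3((k^2)^* )$ satisfying $\mu(P)^{\otimes3}\cdot(\alpha^3)=(\mu(P)\cdot\alpha)^3$ for all $\alpha\in(k^2)^*$.
   Context: $k$ is a field of characteristic different from $2$ and $3$; $x,y$ is the standard coordinate basis of $(k^2)^*$; $S^3((k^2)^* )=\{ax^3+3bx^2y+3cxy^2+dy^3: a,b,c,d\in k\}$ is the space of binary cubics. In this statement $Q$ denotes a binary cubic. The symplectic form is $\omega(P,P')=ad'-da'-3bc'+3cb'$ for $P=ax^3+3bx^2y+3cxy^2+dy^3$, $P'=a'x^3+3b'x^2y+3c'xy^2+d'y^3$. The Lie algebra $\mathfrak{sl}(2,k)$ acts on $(k^2)^*$ by negative transpose: $\begin{pmatrix}\alpha&\beta\\ \gamma&-\alpha\end{pmatrix}\cdot x=-\alpha x-\beta y$, $\begin{pmatrix}\alpha&\beta\\ \gamma&-\alpha\end{pmatrix}\cdot y=-\gamma x+\alpha y$, and acts on $S^3((k^2)^* )$ by extending this action as derivations. For $P=ax^3+3bx^2y+3cxy^2+dy^3$: $$\mu(P)=\begin{pmatrix} ad-bc & 2(bd-c^2)\\ 2(b^2-ac) & -(ad-bc)\end{pmatrix}\in\mathfrak{sl}(2,k),\qquad \Psi(P)=\mu(P)\cdot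 P,$$ $$Q_n(P)=-\det\mu(P)=a^2d^2-3b^2c^2-6abcd+4b^3d+4ac^3.$$ *)

theory Defs
  imports "HOL-Analysis.Determinants" "HOL-Computational_Algebra.Polynomial"
begin

text \<open>
  The symmetric algebra of \<open>(k\<^sup>2)\<^sup>*\<close> is the polynomial ring \<open>k[x,y]\<close>, represented here as
  \<open>k[x][y]\<close>, i.e. by the type \<^typ>\<open>'a poly poly\<close> whose outer variable is \<open>y\<close>.
  The degree-one part is \<open>(k\<^sup>2)\<^sup>*\<close> itself and the degree-three part is the space of binary cubics.
\<close>

definition cst :: "'a::field \<Rightarrow> 'a poly poly" where
  "cst c = [:[:c:]:]"

definition varx :: "'a::field poly poly" where
  "varx = [:[:0, 1:]:]"

definition vary :: "'a::field poly poly" where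
  "vary = [:0, 1:]"

definition linear_form :: "'a::field \<Rightarrow> 'a \<Rightarrow> 'a poly poly" where
  "linear_form p q = cst p * varx + cst q * vary"

definition dual_plane :: "'a::field poly poly set" where
  "dual_plane = {linear_form p q | p q. True}"

definition cubic :: "'a::field \<Rightarrow> 'a \<Rightarrow> 'a \<Rightarrow> 'a \<Rightarrow> 'a poly poly" where
  "cubic a b c d =
     cst a * varx ^ 3 + cst (3 * b) * varx ^ 2 * vary + cst (3 * c) * varx * vary ^ 2 + cst d * vary ^ 3"

definition binary_cubics :: "'a::field poly poly set" where
  "binary_cubics = {cubic a b c d | a b c d. True}"

text \<open>
  The coordinates \<open>a, b, c, d\<close> of \<open>a x\<^sup>3 + 3 b x\<^sup>2 y + 3 c x y\<^sup>2 + d y\<^sup>3\<close>; they are well defined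
  when \<open>3 \<noteq> 0\<close> (lemma \<open>coord_cubic\<close> below).
\<close>

definition coord_a :: "'a::field poly poly \<Rightarrow> 'a" where
  "coord_a P = coeff (coeff P 0) 3"

definition coord_b :: "'a::field poly poly \<Rightarrow> 'a" where
  "coord_b P = coeff (coeff P 1) 2 / 3"

definition coord_c :: "'a::field poly poly \<Rightarrow> 'a" where
  "coord_c P = coeff (coeff P 2) 1 / 3"

definition coord_d :: "'a::field poly poly \<Rightarrow> 'a" where
  "coord_d P = coeff (coeff P 3) 0"

definition symp :: "'a::field poly poly \<Rightarrow> 'a poly poly \<Rightarrow> 'a" where
  "symp P P' =
     coord_a P * coord_d P' - coord_d P * coord_a P'
     - 3 * coord_b P * coord_c P' + 3 * coord_c P * coord_b P'"

text \<open>
  A matrix \<open>A\<close> acts on \<open>(k\<^sup>2)\<^sup>*\<close> by its negative transpose and on \<open>k[x,y]\<close> by the derivation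
  extending this, namely \<open>(A \<cdot> x) \<partial>/\<partial>x + (A \<cdot> y) \<partial>/\<partial>y\<close>. The lemmas \<open>sl2_act_varx\<close> to
  \<open>sl2_act_unique\<close> below show that it is the unique \<open>k\<close>-linear derivation with the prescribed
  values on \<open>x\<close> and \<open>y\<close>.
\<close>

definition sl2_act :: "'a::field ^ 2 ^ 2 \<Rightarrow> 'a poly poly \<Rightarrow> 'a poly poly" where
  "sl2_act A P =
     map_poly pderiv P * linear_form (- (A $ 1 $ 1)) (- (A $ 1 $ 2))
     + pderiv P * linear_form (- (A $ 2 $ 1)) (- (A $ 2 $ 2))"

definition mu :: "'a::field poly poly \<Rightarrow> 'a ^ 2 ^ 2" where
  "mu P = (let a = coord_a P; b = coord_b P; c = coord_c P; d = coord_d P in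
     vector [vector [a * d - b * c, 2 * (b * d - c ^ 2)],
             vector [2 * (b ^ 2 - a * c), - (a * d - b * c)]])"

definition Psi :: "'a::field poly poly \<Rightarrow> 'a poly poly" where
  "Psi P = sl2_act (mu P) P"

definition Qn :: "'a::field poly poly \<Rightarrow> 'a" where
  "Qn P = - det (mu P)"

text \<open>
  Endomorphisms of the space of binary cubics are taken to be extensional (\<^const>\<open>undefined\<close>
  outside the space), so that uniqueness of an endomorphism is meaningful. Existence and
  uniqueness of the endomorphism \<open>tensor_cube A\<close>, for \<open>2 \<noteq> 0\<close> and \<open>3 \<noteq> 0\<close>, are
  lemma \<open>tensor_cube_ex1\<close>.
\<close>

definition cubic_endos :: "('a::field poly poly \<Rightarrow> 'a poly poly) set" where
  "cubic_endos = {T \<in> binary_cubics \<rightarrow>\<^sub>E binary_cubics.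
     (\<forall>P\<in>binary_cubics. \<forall>P'\<in>binary_cubics. T (P + P') = T P + T P') \<and>
     (\<forall>r. \<forall>P\<in>binary_cubics. T (cst r * P) = cst r * T P)}"

definition tensor_cube :: "'a::field ^ 2 ^ 2 \<Rightarrow> 'a poly poly \<Rightarrow> 'a poly poly" where
  "tensor_cube A =
     (THE T. T \<in> cubic_endos \<and> (\<forall>\<alpha>\<in>dual_plane. T (\<alpha> ^ 3) = (sl2_act A \<alpha>) ^ 3))"


lemma cst_simps:
  "cst (a + b) = cst a + cst b" "cst (a - b) = cst a - cst b" "cst (a * b) = cst a * cst b"
  "cst (- a) = - cst a" "cst 0 = 0" "cst 1 = 1" "cst (numeral n) = numeral n"
  by (simp_all add: cst_def numeral_poly one_pCons)

lemma char_ne_2_3_imp: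
  assumes "CHAR('a::field) \<noteq> 2" "CHAR('a) \<noteq> 3"
  shows "(2::'a) \<noteq> 0" "(3::'a) \<noteq> 0"
proof -
  have *: "CHAR('a) \<noteq> 1" by simp
  show "(2::'a) \<noteq> 0"
  proof
    assume "(2::'a) = 0"
    hence "of_nat 2 = (0::'a)" by simp
    hence "CHAR('a) dvd 2" by (simp only: of_nat_eq_0_iff_char_dvd)
    thus False using assms * two_is_prime_nat by (auto simp: prime_nat_iff)
  qed
  show "(3::'a) \<noteq> 0"
  proof
    assume "(3::'a) = 0"
    hence "of_nat 3 = (0::'a)" by simp
    hence "CHAR('a) dvd 3" by (simp only: of_nat_eq_0_iff_char_dvd)
    moreover have "prime (3::nat)" by simp
    ultimately show False using assms * by (auto simp: prime_nat_iff)
  qed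
qed

lemma coord_cubic:
  assumes "(3::'a::field) \<noteq> 0"
  shows "coord_a (cubic a b c d) = (a::'a)" "coord_b (cubic a b c d) = b"
    "coord_c (cubic a b c d) = c" "coord_d (cubic a b c d) = d"
  using assms
  by (simp_all add: cubic_def coord_a_def coord_b_def coord_c_def coord_d_def cst_def
      varx_def vary_def eval_nat_numeral)

lemma trace_mu: "trace (mu P) = 0"
  by (simp add: mu_def Let_def trace_def sum_2)

lemma Qn_cubic:
  assumes "(3::'a::field) \<noteq> 0"
  shows "Qn (cubic a b c (d::'a)) =
    a^2 * d^2 - 3 * b^2 * c^2 - 6 * a * b * c * d + 4 * b^3 * d + 4 * a * c^3"
  using assms
  by (simp add: Qn_def mu_def coord_cubic Let_def det_2) algebra

lemma sl2_act_varx: "sl2_act A varx = linear_form (- (A $ 1 $ 1)) (- (A $ 1 $ 2))"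
  by (simp add: sl2_act_def varx_def map_poly_pCons pderiv_pCons flip: one_pCons)

lemma sl2_act_vary: "sl2_act A vary = linear_form (- (A $ 2 $ 1)) (- (A $ 2 $ 2))"
  by (simp add: sl2_act_def vary_def map_poly_pCons pderiv_pCons)

lemma sl2_act_cst: "sl2_act A (cst c) = 0"
  by (simp add: sl2_act_def cst_def map_poly_pCons pderiv_pCons)

lemma map_pderiv_add:
  fixes P R :: "'a::field poly poly"
  shows "map_poly pderiv (P + R) = map_poly pderiv P + map_poly pderiv R"
  by (rule poly_eqI) (simp add: coeff_map_poly pderiv_add)

lemma map_pderiv_mult:
  fixes P R :: "'a::field poly poly"
  shows "map_poly pderiv (P * R) = map_poly pderiv P * R + P * map_poly pderiv R"
  by (rule poly_eqI)
    (simp add: coeff_map_poly coeff_mult higher_pderiv_sum[where n = 1, simplified] pderiv_mult sum.distrib,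
      simp add: mult.commute add.commute)

lemma sl2_act_add: "sl2_act A (P + R) = sl2_act A P + sl2_act A R"
  by (simp add: sl2_act_def map_pderiv_add pderiv_add algebra_simps)

lemma sl2_act_mult: "sl2_act A (P * R) = sl2_act A P * R + P * sl2_act A R"
  by (simp add: sl2_act_def map_pderiv_mult pderiv_mult algebra_simps)

lemma sl2_act_unique:
  fixes D :: "'a::field poly poly \<Rightarrow> 'a poly poly"
  assumes add: "\<And>P R. D (P + R) = D P + D R"
    and mult: "\<And>P R. D (P * R) = D P * R + P * D R"
    and cst: "\<And>c. D (cst c) = 0"
    and x: "D varx = linear_form (- (A $ 1 $ 1)) (- (A $ 1 $ 2))"
    and y: "D vary = linear_form (- (A $ 2 $ 1)) (- (A $ 2 $ 2))"
  shows "D = sl2_act A"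
proof
  have zero: "D 0 = 0" using cst[of 0] by (simp add: cst_simps)
  have zero': "sl2_act A 0 = 0" by (simp add: sl2_act_def)
  have inner: "D [:p:] = sl2_act A [:p:]" for p
  proof (induction p)
    case (pCons a p)
    have eq: "[:pCons a p:] = cst a + varx * [:p:]"
      by (simp add: cst_def varx_def)
    show ?case
      unfolding eq add mult sl2_act_add sl2_act_mult cst sl2_act_cst x sl2_act_varx pCons.IH ..
  qed (simp add: zero zero')
  show "D P = sl2_act A P" for P
  proof (induction P)
    case (pCons p P)
    have eq: "pCons p P = [:p:] + vary * P"
      by (simp add: vary_def)
    show ?case
      unfolding eq add mult sl2_act_add sl2_act_mult y sl2_act_vary pCons.IH inner ..
  qed (simp add: zero zero')
qed

lemma sl2_act_linear_form:
  "sl2_act A (linear_form p q) = cst p * sl2_act A varx + cst q * sl2_act A vary"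
  by (simp add: linear_form_def sl2_act_add sl2_act_mult sl2_act_cst)

lemma tensor_cube_ex1:
  fixes A :: "'a::field ^ 2 ^ 2"
  assumes two: "(2::'a) \<noteq> 0" and three: "(3::'a) \<noteq> 0"
  shows "\<exists>!T. T \<in> cubic_endos \<and> (\<forall>\<alpha>\<in>dual_plane. T (\<alpha> ^ 3) = (sl2_act A \<alpha>) ^ 3)"
proof -
  have cubic_mem: "cubic a b c d \<in> binary_cubics" for a b c d :: 'a
    by (auto simp: binary_cubics_def)
  have lin_mem: "linear_form p q \<in> dual_plane" for p q :: 'a
    by (auto simp: dual_plane_def)
  have cubic_elim: "\<exists>a b c d. R = cubic a b c d" if "R \<in> binary_cubics" for R :: "'a poly poly"
    using that by (auto simp: binary_cubics_def)
  have cubic_add: "cubic a b c d + cubic a' b' c' d' = cubic (a+a') (b+b') (c+c') (d+d')"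
    for a b c d a' b' c' d' :: 'a
    by (simp add: cubic_def cst_simps algebra_simps)
  have cubic_scale: "cst r * cubic a b c d = cubic (r*a) (r*b) (r*c) (r*d)" for r a b c d :: 'a
    by (simp add: cubic_def cst_simps algebra_simps)
  have cube: "linear_form p q ^ 3 = cubic (p^3) (p^2*q) (p*q^2) (q^3)" for p q :: 'a
    by (simp add: linear_form_def cubic_def cst_simps power3_eq_cube power2_eq_square algebra_simps)
  have third: "3 * (x / 3) = x" for x :: 'a
    using three by simp
  have prod3: "linear_form p q * linear_form r s * linear_form t u
      = cubic (p * r * t) ((p * r * u + p * s * t + q * r * t) / 3) ((p * s * u + q * r * u + q * s * t) / 3) (q * s * u)"
    for p q r s t u :: 'a
    unfolding cubic_def third
    by (simp add: linear_form_def cst_simps power3_eq_cube power2_eq_square algebra_simps)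
  have lin3_mem: "linear_form p q * linear_form r s * linear_form t u \<in> binary_cubics"
    for p q r s t u :: 'a
    unfolding prod3 by (rule cubic_mem)
  have add_mem: "R + S \<in> binary_cubics" if "R \<in> binary_cubics" "S \<in> binary_cubics"
    for R S :: "'a poly poly"
    using that by (auto dest!: cubic_elim simp: cubic_add cubic_mem)
  have scale_mem: "cst r * R \<in> binary_cubics" if "R \<in> binary_cubics" for r and R :: "'a poly poly"
    using that by (auto dest!: cubic_elim simp: cubic_scale cubic_mem)
  define U where "U = sl2_act A varx"
  define V where "V = sl2_act A vary"
  define f where "f = (\<lambda>P. cst (coord_a P) * (U * U * U) + cst (3 * coord_b P) * (U * U * V)
      + cst (3 * coord_c P) * (U * V * V) + cst (coord_d P) * (V * V * V))"
  define T where "T = restrict f binary_cubics"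
  have f_mem: "f P \<in> binary_cubics" for P
    unfolding f_def U_def V_def sl2_act_varx sl2_act_vary
    by (intro add_mem scale_mem lin3_mem)
  have T_cubic: "T (cubic a b c d) = cst a * (U * U * U) + cst (3 * b) * (U * U * V)
      + cst (3 * c) * (U * V * V) + cst d * (V * V * V)" for a b c d
    by (simp add: T_def cubic_mem f_def coord_cubic[OF three])
  have 1: "T \<in> cubic_endos"
    unfolding cubic_endos_def
  proof (intro CollectI conjI ballI allI)
    show "T \<in> binary_cubics \<rightarrow>\<^sub>E binary_cubics"
      by (auto simp: T_def f_mem)
    show "T (P + P') = T P + T P'" if "P \<in> binary_cubics" "P' \<in> binary_cubics" for P P'
      using that
      by (auto dest!: cubic_elim simp: cubic_add T_cubic cst_simps algebra_simps)
    show "T (cst r * P) = cst r * T P" if "P \<in> binary_cubics" for r P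
      using that by (auto dest!: cubic_elim simp: cubic_scale T_cubic cst_simps algebra_simps)
  qed
  have 2: "T (\<alpha> ^ 3) = (sl2_act A \<alpha>) ^ 3" if \<alpha>: "\<alpha> \<in> dual_plane" for \<alpha>
  proof -
    from \<alpha> obtain p q where "\<alpha> = linear_form p q" by (auto simp: dual_plane_def)
    thus ?thesis
      by (simp only: cube T_cubic sl2_act_linear_form flip: U_def V_def)
        (simp add: cst_simps power3_eq_cube power2_eq_square algebra_simps)
  qed
  have decomp: "S (cubic a b c d) = cst (a - c) * S (linear_form 1 0 ^ 3)
      + cst (d - b) * S (linear_form 0 1 ^ 3)
      + cst ((b + c) / 2) * S (linear_form 1 1 ^ 3) + cst ((c - b) / 2) * S (linear_form 1 (-1) ^ 3)"
    if "S \<in> cubic_endos" for S and a b c d :: 'a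
  proof -
    have eq: "cubic a b c d = cst (a - c) * cubic 1 0 0 0 + cst (d - b) * cubic 0 0 0 1
        + cst ((b + c) / 2) * cubic 1 1 1 1 + cst ((c - b) / 2) * cubic 1 (-1) 1 (-1)"
    proof -
      have b: "(b + c) / 2 - (c - b) / 2 = b" and c: "(b + c) / 2 + (c - b) / 2 = c"
        using two by (simp_all flip: diff_divide_distrib add_divide_distrib mult_2)
      have d: "d - b + (b + c) / 2 - (c - b) / 2 = d"
        unfolding add_diff_eq[symmetric] b by simp
      have a: "a - c + (b + c) / 2 + (c - b) / 2 = a"
        unfolding add.assoc c by simp
      show ?thesis
        unfolding cubic_add cubic_scale by (simp add: a b c d)
    qed
    have S_add: "S (P + P') = S P + S P'"
      if "P \<in> binary_cubics" "P' \<in> binary_cubics" for P P'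
      using that \<open>S \<in> cubic_endos\<close> by (auto simp: cubic_endos_def)
    have S_scale: "S (cst r * P) = cst r * S P" if "P \<in> binary_cubics" for P r
      using that \<open>S \<in> cubic_endos\<close> by (auto simp: cubic_endos_def)
    show ?thesis
      unfolding eq by (simp add: S_add S_scale add_mem scale_mem cubic_mem cube)
  qed
  show ?thesis
  proof (rule ex1I[of _ T])
    show "T \<in> cubic_endos \<and> (\<forall>\<alpha>\<in>dual_plane. T (\<alpha> ^ 3) = (sl2_act A \<alpha>) ^ 3)"
      using 1 2 by blast
    fix S assume S: "S \<in> cubic_endos \<and> (\<forall>\<alpha>\<in>dual_plane. S (\<alpha> ^ 3) = (sl2_act A \<alpha>) ^ 3)"
    show "S = T"
    proof
      fix P
      show "S P = T P"
      proof (cases "P \<in> binary_cubics")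
        case True
        then obtain a b c d where P: "P = cubic a b c d" by (auto simp: binary_cubics_def)
        show ?thesis
          unfolding P decomp[OF conjunct1[OF S]] decomp[OF 1]
            bspec[OF conjunct2[OF S] lin_mem] 2[OF lin_mem] ..
      next
        case False
        have "S \<in> binary_cubics \<rightarrow>\<^sub>E binary_cubics" "T \<in> binary_cubics \<rightarrow>\<^sub>E binary_cubics"
          using S 1 by (simp_all add: cubic_endos_def)
        thus ?thesis using False by (metis PiE_arb)
      qed
    qed
  qed
qed

end

theory Submission
  imports Defs
begin

text \<open>
  Over an algebraic closure suppose \<open>Qn P \<noteq> 0\<close>. Then \<open>P = u\<^sup>3 + v\<^sup>3\<close> with linear forms \<open>u\<close>, \<open>v\<close> that
  are eigenvectors of \<open>mu P\<close> for eigenvalues \<open>t\<close> and \<open>- t\<close>, where \<open>t\<^sup>2 = Qn P\<close>. Consequently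
  \<open>Psi P = 3 t (u\<^sup>3 - v\<^sup>3)\<close>, and the left-hand side is a difference of squares that collapses to the
  single product \<open>- 36 t\<^sup>2 \<omega>(u\<^sup>3, Q) \<omega>(v\<^sup>3, Q)\<close>.

  On the other side write \<open>Q = p u\<^sup>3 + 3 q u\<^sup>2 v + 3 r u v\<^sup>2 + s v\<^sup>3\<close>. Both the tensor cube of \<open>mu P\<close> and
  \<open>t\<^sup>2\<close> times the derivation \<open>mu P\<close> are diagonal on these four monomials, with eigenvalues
  \<open>t\<^sup>3, - t\<^sup>3, t\<^sup>3, - t\<^sup>3\<close> and \<open>3 t\<^sup>3, t\<^sup>3, - t\<^sup>3, - 3 t\<^sup>3\<close>. In the sum the two middle terms cancel,
  so again only the product \<open>p s\<close> of the two extreme coefficients of \<open>Q\<close> survives.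

  That common value is a multiple of the product of the values of \<open>Q\<close> at the two eigenvectors of \<open>mu P\<close>
  acting on the plane. For suitably scaled eigenvectors this product is a resultant, hence polynomial
  in the entries of \<open>mu P\<close> and the coefficients of \<open>Q\<close>, so it makes sense over \<open>k\<close> and also when \<open>Qn P = 0\<close>; it is \<open>eigen_resultant\<close> below.
  The lemmas \<open>symp_tensor_cube_plus_act\<close> and \<open>symp_Psi_square_diff\<close> identify the two sides of the
  theorem with multiples of it. They are integral polynomial identities in the coefficients, so they
  are checked by expansion, with no field extension. What needs an argument is the value of the
  tensor cube on an arbitrary cubic, since it is characterised only on cubes of linear forms.
\<close>

lemma symp_cubic:
  assumes "(3::'a::field) \<noteq> 0"
  shows "symp (cubic a b c d) (cubic a' b' c' d') = a * d' - d * a' - 3 * b * c' + 3 * c * (b'::'a)"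
  by (simp add: symp_def coord_cubic[OF assms])

lemma cubic_add:
  "cubic a b c d + cubic a' b' c' d' = cubic (a + a') (b + b') (c + c') (d + d')"
  by (simp add: cubic_def cst_simps algebra_simps)

lemma cubic_scale: "cst t * cubic a b c d = cubic (t * a) (t * b) (t * c) (t * d)"
  by (simp add: cubic_def cst_simps algebra_simps)

lemma sl2_act_cubic:
  fixes A :: "'a::field ^ 2 ^ 2"
  shows "sl2_act A (cubic a b c d) = cubic
    (- 3 * (A$1$1 * a + A$2$1 * b))
    (- (A$1$2 * a) - (2 * A$1$1 + A$2$2) * b - 2 * A$2$1 * c)
    (- 2 * A$1$2 * b - (A$1$1 + 2 * A$2$2) * c - A$2$1 * d)
    (- 3 * (A$1$2 * c + A$2$2 * d))"
  unfolding cubic_def power3_eq_cube power2_eq_square sl2_act_add sl2_act_mult sl2_act_cst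
      sl2_act_varx sl2_act_vary linear_form_def
  by (simp add: cst_simps algebra_simps)

text \<open>
  The tensor cube is the substitution \<open>x \<mapsto> A \<cdot> x\<close>, \<open>y \<mapsto> A \<cdot> y\<close>. As \<open>2\<close> is invertible, the four
  cubes \<open>x\<^sup>3\<close>, \<open>(x + y)\<^sup>3\<close>, \<open>(x - y)\<^sup>3\<close>, \<open>y\<^sup>3\<close> span the binary cubics, and on them the value is
  prescribed.
\<close>
lemma tensor_cube_cubic:
  fixes A :: "'a::field ^ 2 ^ 2"
  assumes two: "(2::'a) \<noteq> 0" and three: "(3::'a) \<noteq> 0"
  defines "U \<equiv> sl2_act A varx" and "V \<equiv> sl2_act A vary"
  shows "tensor_cube A (cubic p q r s) =
    cst p * U ^ 3 + 3 * cst q * U ^ 2 * V + 3 * cst r * U * V ^ 2 + cst s * V ^ 3"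
proof -
  let ?T = "tensor_cube A"
  have endo: "?T \<in> cubic_endos"
    and T_cube: "\<forall>\<alpha>\<in>dual_plane. ?T (\<alpha> ^ 3) = (sl2_act A \<alpha>) ^ 3"
    using theI'[OF tensor_cube_ex1[OF two three, of A]] unfolding tensor_cube_def by blast+
  have lin: "linear_form m n \<in> dual_plane" for m n :: 'a
    by (auto simp: dual_plane_def)
  have mem: "cubic a b c d \<in> binary_cubics" for a b c d :: 'a
    by (auto simp: binary_cubics_def)
  have add_mem: "R + S \<in> binary_cubics" if "R \<in> binary_cubics" "S \<in> binary_cubics"
    for R S :: "'a poly poly"
    using that by (clarsimp simp: binary_cubics_def cubic_add) blast
  have scale_mem: "cst t * R \<in> binary_cubics" if "R \<in> binary_cubics" for t and R :: "'a poly poly"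
    using that by (clarsimp simp: binary_cubics_def cubic_scale) blast
  have T_add: "?T (R + S) = ?T R + ?T S" if "R \<in> binary_cubics" "S \<in> binary_cubics" for R S
    using endo that by (auto simp: cubic_endos_def)
  have T_scale: "?T (cst t * R) = cst t * ?T R" if "R \<in> binary_cubics" for t R
    using endo that by (auto simp: cubic_endos_def)
  have cube: "linear_form m n ^ 3 = cubic (m^3) (m^2 * n) (m * n^2) (n^3)" for m n :: 'a
    by (simp add: linear_form_def cubic_def cst_simps power3_eq_cube power2_eq_square algebra_simps)
  have T_lin: "?T (cubic (m^3) (m^2 * n) (m * n^2) (n^3)) = (cst m * U + cst n * V) ^ 3" for m n :: 'a
    using bspec[OF T_cube lin, of m n] by (simp add: cube sl2_act_linear_form U_def V_def)
  \<comment> \<open>The coefficients of \<open>(x + y)\<^sup>3\<close> and \<open>(x - y)\<^sup>3\<close> are forced by the middle coefficients \<open>q\<close>, \<open>r\<close>.\<close>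
  define h where "h = (r + q) / 2"
  define k where "k = (r - q) / 2"
  have hk: "r = h + k" "q = h - k"
    using two by (simp_all add: h_def k_def flip: add_divide_distrib diff_divide_distrib mult_2)
  have "cubic p q r s = cst (p - r) * cubic 1 0 0 0 + cst h * cubic 1 1 1 1
      + cst k * cubic 1 (- 1) 1 (- 1) + cst (s - q) * cubic 0 0 0 1"
    by (simp add: cubic_add cubic_scale hk)
  also have "?T \<dots> = cst (p - r) * ?T (cubic 1 0 0 0) + cst h * ?T (cubic 1 1 1 1)
      + cst k * ?T (cubic 1 (- 1) 1 (- 1)) + cst (s - q) * ?T (cubic 0 0 0 1)"
    by (simp only: T_add add_mem scale_mem mem T_scale)
  also have "\<dots> = cst (p - r) * U ^ 3 + cst h * (U + V) ^ 3 + cst k * (U - V) ^ 3 + cst (s - q) * V ^ 3"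
    using T_lin[of 1 0] T_lin[of 1 1] T_lin[of 1 "- 1"] T_lin[of 0 1] by (simp add: cst_simps)
  also have "\<dots> = cst p * U ^ 3 + 3 * cst q * U ^ 2 * V + 3 * cst r * U * V ^ 2 + cst s * V ^ 3"
    by (simp add: hk cst_simps power3_eq_cube power2_eq_square algebra_simps)
  finally show ?thesis .
qed

text \<open>
  For \<open>A\<close> of trace zero this is the resultant of \<open>Q\<close> with the binary quadratic form
  \<open>- \<gamma> x\<^sup>2 + 2 \<alpha> x y + \<beta> y\<^sup>2\<close>, whose nontrivial zeros are the eigenvectors of \<open>A\<close>; over an
  algebraic closure it is \<open>Q(\<xi>) Q(\<eta>)\<close> for eigenvectors \<open>\<xi>\<close>, \<open>\<eta>\<close> scaled so that this form is
  \<open>(\<xi>\<^sub>2 x - \<xi>\<^sub>1 y) (\<eta>\<^sub>2 x - \<eta>\<^sub>1 y)\<close>.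
\<close>

definition eigen_resultant :: "'a::field ^ 2 ^ 2 \<Rightarrow> 'a poly poly \<Rightarrow> 'a" where
  "eigen_resultant A Q =
    (let \<alpha> = A$1$1; \<beta> = A$1$2; \<gamma> = A$2$1;
         p = coord_a Q; q = coord_b Q; r = coord_c Q; s = coord_d Q in
      \<beta>^3 * p^2 - 6 * \<alpha> * \<beta>^2 * p * q + (12 * \<alpha>^2 * \<beta> + 6 * \<beta>^2 * \<gamma>) * p * r
      - (8 * \<alpha>^3 + 6 * \<alpha> * \<beta> * \<gamma>) * p * s - 9 * \<beta>^2 * \<gamma> * q^2 + 18 * \<alpha> * \<beta> * \<gamma> * q * r
      + 9 * \<beta> * \<gamma>^2 * r^2 - (12 * \<alpha>^2 * \<gamma> + 6 * \<beta> * \<gamma>^2) * q * s - 6 * \<alpha> * \<gamma>^2 * r * s - \<gamma>^3 * s^2)"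

text \<open>
  In an eigenbasis of \<open>A\<close> the mixed coefficients of \<open>Q\<close> cancel between the two summands; this is why the
  derivation enters with the weight \<open>- det A\<close>.
\<close>

lemma symp_tensor_cube_plus_act:
  fixes A :: "'a::field ^ 2 ^ 2"
  assumes two: "(2::'a) \<noteq> 0" and three: "(3::'a) \<noteq> 0"
    and traceless: "A$2$2 = - A$1$1" and Q: "Q \<in> binary_cubics"
  shows "symp (tensor_cube A Q) Q + (- det A) * symp (sl2_act A Q) Q = eigen_resultant A Q"
proof -
  obtain p q r s where Q: "Q = cubic p q r s"
    using Q by (auto simp: binary_cubics_def)
  define \<alpha> \<beta> \<gamma> where "\<alpha> = A$1$1" and "\<beta> = A$1$2" and "\<gamma> = A$2$1"
  have A: "A$1$1 = \<alpha>" "A$1$2 = \<beta>" "A$2$1 = \<gamma>" "A$2$2 = - \<alpha>"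
    by (simp_all add: \<alpha>_def \<beta>_def \<gamma>_def traceless)
  have cube: "tensor_cube A Q = cubic
      (- (\<alpha>^3 * p + 3 * \<alpha>^2 * \<gamma> * q + 3 * \<alpha> * \<gamma>^2 * r + \<gamma>^3 * s))
      (- (\<alpha>^2 * \<beta> * p) + (\<alpha>^2 - 2 * \<beta> * \<gamma>) * \<alpha> * q + (2 * \<alpha>^2 - \<beta> * \<gamma>) * \<gamma> * r + \<alpha> * \<gamma>^2 * s)
      (- (\<alpha> * \<beta>^2 * p) + (2 * \<alpha>^2 - \<beta> * \<gamma>) * \<beta> * q + (2 * \<beta> * \<gamma> - \<alpha>^2) * \<alpha> * r - \<alpha>^2 * \<gamma> * s)
      (- (\<beta>^3 * p) + 3 * \<alpha> * \<beta>^2 * q - 3 * \<alpha>^2 * \<beta> * r + \<alpha>^3 * s)"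
    unfolding Q tensor_cube_cubic[OF two three] sl2_act_varx sl2_act_vary A
    by (simp add: linear_form_def cubic_def cst_simps power3_eq_cube power2_eq_square algebra_simps)
  show ?thesis
    unfolding cube unfolding Q sl2_act_cubic symp_cubic[OF three] eigen_resultant_def
      coord_cubic[OF three] Let_def det_2 A
    by (simp add: algebra_simps power2_eq_square power3_eq_cube)
qed

text \<open>
  The left-hand side factors as \<open>(\<omega>(Psi P, Q) - 3 t \<omega>(P, Q)) (\<omega>(Psi P, Q) + 3 t \<omega>(P, Q))\<close> with
  \<open>t\<^sup>2 = Qn P\<close>. In characteristic other than \<open>2\<close> and for \<open>t \<noteq> 0\<close>, each of \<open>Psi P \<plusminus> 3 t P\<close> is a multiple of the cube of an eigenform of
  \<open>mu P\<close>, so pairing with it evaluates \<open>Q\<close> at an eigenvector, up to a scalar.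
\<close>

lemma symp_Psi_square_diff:
  fixes P Q :: "'a::field poly poly"
  assumes three: "(3::'a) \<noteq> 0" and P: "P \<in> binary_cubics" and Q: "Q \<in> binary_cubics"
  shows "2 * ((symp (Psi P) Q)\<^sup>2 - 9 * Qn P * (symp P Q)\<^sup>2) = - 9 * eigen_resultant (mu P) Q"
proof -
  obtain a b c d where P: "P = cubic a b c d"
    using P by (auto simp: binary_cubics_def)
  obtain p q r s where Q: "Q = cubic p q r s"
    using Q by (auto simp: binary_cubics_def)
  define \<alpha> \<beta> \<gamma> where "\<alpha> = a * d - b * c" and "\<beta> = 2 * (b * d - c\<^sup>2)" and "\<gamma> = 2 * (b\<^sup>2 - a * c)"
  have mu: "mu P $ 1 $ 1 = \<alpha>" "mu P $ 1 $ 2 = \<beta>" "mu P $ 2 $ 1 = \<gamma>" "mu P $ 2 $ 2 = - \<alpha>"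
    by (simp_all add: P mu_def Let_def coord_cubic[OF three] \<alpha>_def \<beta>_def \<gamma>_def)
  have Qn: "Qn P = \<alpha>\<^sup>2 + \<beta> * \<gamma>"
    by (simp add: Qn_def det_2 mu power2_eq_square)
  have psi: "symp (Psi P) Q = 3 * (- (\<alpha> * a + \<gamma> * b) * s + (\<beta> * c - \<alpha> * d) * p
      + (\<beta> * a + \<alpha> * b + 2 * \<gamma> * c) * r + (\<alpha> * c - 2 * \<beta> * b - \<gamma> * d) * q)"
    unfolding Psi_def
    by (subst (2) P, simp add: Q sl2_act_cubic symp_cubic[OF three] mu algebra_simps)
  have omega: "symp P Q = a * s - d * p - 3 * b * r + 3 * c * q"
    by (simp add: P Q symp_cubic[OF three])
  show ?thesis
    unfolding psi omega Qn eigen_resultant_def mu Let_def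
    unfolding Q coord_cubic[OF three] \<alpha>_def \<beta>_def \<gamma>_def
    by (simp add: algebra_simps power2_eq_square power3_eq_cube)
qed

theorem theorem5p1:
  fixes P Q :: "'a::field poly poly"
  assumes "CHAR('a) \<noteq> 2" and "CHAR('a) \<noteq> 3"
    and "P \<in> binary_cubics" and "Q \<in> binary_cubics"
  shows "(symp (Psi P) Q)\<^sup>2 - 9 * Qn P * (symp P Q)\<^sup>2 =
    - (9 / 2) * symp (tensor_cube (mu P) Q) Q - (9 / 2) * Qn P * symp (sl2_act (mu P) Q) Q"
proof -
  note two = char_ne_2_3_imp(1)[OF assms(1,2)] and three = char_ne_2_3_imp(2)[OF assms(1,2)]
  have "mu P $ 2 $ 2 = - mu P $ 1 $ 1"
    by (simp add: mu_def Let_def)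
  from symp_tensor_cube_plus_act[OF two three this assms(4)]
  have rhs: "symp (tensor_cube (mu P) Q) Q + Qn P * symp (sl2_act (mu P) Q) Q
      = eigen_resultant (mu P) Q"
    unfolding Qn_def .
  have halve: "w = - (9 / 2) * z" if "2 * w = - 9 * z" for w z :: 'a
  proof -
    have "w = 2 * w / 2"
      using two by simp
    then show ?thesis
      by (simp add: that)
  qed
  show ?thesis
    unfolding halve[OF symp_Psi_square_diff[OF three assms(3,4)]] rhs[symmetric]
    by (simp add: algebra_simps)
qed

end
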